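(* Let $R$ be a nonzero ring. Then the ring $\mathbb{LTDFM}_{\mathbb{N}}(R)$ of lower-triangular diagonal-finite matrices over $R$ is not an exchange ring.
   Context: Rings are associative with unity. Let $\mathbb{N} = \{1,2,3,\dots\}$ index rows and columns, and let $\mathbb{CFM}_{\mathbb{N}}(R)$ denote the ring of column-finite matrices $A = (a_{ij})_{i,j=1}^{\infty}$ over $R$ (each column has only finitely many nonzero entries), where $i$ is the row index and $j$ the column index. The ring $\mathbb{LTDFM}_{\mathbb{N}}(R)$ is the subring of $\mathbb{CFM}_{\mathbb{N}}(R)$ consisting of all $A = (a_{ij})$ that are lower triangular ($a_{ij} = 0$ whenever $i < j$) and diagonal-finite (there exists $n \in \mathbb{N}$ such that $a_{ij} = 0$ for all $j \geq 1$ and all $i \geq j + n$). A ring $S$ is an exchange ring if for every $a \in S$ there is an idempotent $e \in S$ with $e \in Sa$ and $1 - e \in S(1-a)$. *)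

theory Defs
  imports "HOL-Algebra.Subrings"
begin

text \<open>
  Matrices indexed by the positive integers are encoded as functions on all of \<open>nat\<close>, the
  index \<open>k\<close> standing for position \<open>k + 1\<close>; every condition on indices below (\<open>i < j\<close>,
  \<open>i \<ge> j + n\<close>, finiteness of columns) is invariant under this shift. The first argument of a
  matrix is the row, the second the column.

  In the product, the sum over the support of the \<open>j\<close>-th column of \<open>B\<close> is the whole sum over
  \<open>k\<close>; on the carrier this support is finite.
\<close>

definition CFM :: "('a, 'b) ring_scheme \<Rightarrow> (nat \<Rightarrow> nat \<Rightarrow> 'a) ring" where
  "CFM R = \<lparr>
     carrier = {A. (\<forall>i j. A i j \<in> carrier R) \<and> (\<forall>j. finite {i. A i j \<noteq> \<zero>\<^bsub>R\<^esub>})},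
     monoid.mult = (\<lambda>A B i j. \<Oplus>\<^bsub>R\<^esub>k\<in>{k. B k j \<noteq> \<zero>\<^bsub>R\<^esub>}. A i k \<otimes>\<^bsub>R\<^esub> B k j),
     one = (\<lambda>i j. if i = j then \<one>\<^bsub>R\<^esub> else \<zero>\<^bsub>R\<^esub>),
     zero = (\<lambda>i j. \<zero>\<^bsub>R\<^esub>),
     add = (\<lambda>A B i j. A i j \<oplus>\<^bsub>R\<^esub> B i j)\<rparr>"

definition lower_triangular :: "('a, 'b) ring_scheme \<Rightarrow> (nat \<Rightarrow> nat \<Rightarrow> 'a) \<Rightarrow> bool" where
  "lower_triangular R A \<longleftrightarrow> (\<forall>i j. i < j \<longrightarrow> A i j = \<zero>\<^bsub>R\<^esub>)"

definition diagonal_finite :: "('a, 'b) ring_scheme \<Rightarrow> (nat \<Rightarrow> nat \<Rightarrow> 'a) \<Rightarrow> bool" where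
  "diagonal_finite R A \<longleftrightarrow> (\<exists>n\<ge>1. \<forall>j. \<forall>i\<ge>j + n. A i j = \<zero>\<^bsub>R\<^esub>)"

definition LTDFM :: "('a, 'b) ring_scheme \<Rightarrow> (nat \<Rightarrow> nat \<Rightarrow> 'a) ring" where
  "LTDFM R = (CFM R)
     \<lparr>carrier := {A \<in> carrier (CFM R). lower_triangular R A \<and> diagonal_finite R A}\<rparr>"

text \<open>
  The exchange condition for a ring \<open>S\<close>. That \<open>S\<close> is a ring is not part of the predicate, so
  its negation never holds merely because \<open>S\<close> fails to be a ring.
\<close>

definition exchange_ring :: "('a, 'b) ring_scheme \<Rightarrow> bool" where
  "exchange_ring S \<longleftrightarrow>
     (\<forall>a\<in>carrier S. \<exists>e\<in>carrier S. e \<otimes>\<^bsub>S\<^esub> e = e \<and>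
        e \<in> {s \<otimes>\<^bsub>S\<^esub> a | s. s \<in> carrier S} \<and>
        \<one>\<^bsub>S\<^esub> \<ominus>\<^bsub>S\<^esub> e \<in> {s \<otimes>\<^bsub>S\<^esub> (\<one>\<^bsub>S\<^esub> \<ominus>\<^bsub>S\<^esub> a) | s. s \<in> carrier S})"

lemma CFM_sel [simp]:
  "monoid.mult (CFM R) A B i j = (\<Oplus>\<^bsub>R\<^esub>k\<in>{k. B k j \<noteq> \<zero>\<^bsub>R\<^esub>}. A i k \<otimes>\<^bsub>R\<^esub> B k j)"
  "one (CFM R) i j = (if i = j then \<one>\<^bsub>R\<^esub> else \<zero>\<^bsub>R\<^esub>)"
  "zero (CFM R) i j = \<zero>\<^bsub>R\<^esub>"
  "add (CFM R) A B i j = A i j \<oplus>\<^bsub>R\<^esub> B i j"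
  by (simp_all add: CFM_def)

lemma CFM_carrier:
  "A \<in> carrier (CFM R) \<longleftrightarrow>
     (\<forall>i j. A i j \<in> carrier R) \<and> (\<forall>j. finite {i. A i j \<noteq> \<zero>\<^bsub>R\<^esub>})"
  by (simp add: CFM_def)

context ring
begin

lemma finsum_swap:
  assumes "finite A" "finite B" "\<And>i j. i \<in> A \<Longrightarrow> j \<in> B \<Longrightarrow> f i j \<in> carrier R"
  shows "(\<Oplus>i\<in>A. \<Oplus>j\<in>B. f i j) = (\<Oplus>j\<in>B. \<Oplus>i\<in>A. f i j)"
  using assms(1,3)
proof (induction A rule: finite_induct)
  case empty
  then show ?case by (simp add: finsum_zero)
next
  case (insert x F)
  have "(\<Oplus>j\<in>B. \<Oplus>i\<in>insert x F. f i j) = (\<Oplus>j\<in>B. f x j \<oplus> (\<Oplus>i\<in>F. f i j))"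
    using insert by (intro finsum_cong') (auto intro!: finsum_closed finsum_insert)
  also have "\<dots> = (\<Oplus>j\<in>B. f x j) \<oplus> (\<Oplus>j\<in>B. \<Oplus>i\<in>F. f i j)"
    using insert by (intro finsum_addf) (auto intro!: finsum_closed)
  finally show ?case
    using insert by (subst finsum_insert) (auto intro!: finsum_closed)
qed

lemma CFM_mult_eq:
  assumes "A \<in> carrier (CFM R)" "B \<in> carrier (CFM R)"
    and "finite K" "{k. B k j \<noteq> \<zero>} \<subseteq> K"
  shows "(A \<otimes>\<^bsub>CFM R\<^esub> B) i j = (\<Oplus>k\<in>K. A i k \<otimes> B k j)"
  unfolding CFM_sel
  by (rule add.finprod_mono_neutral_cong_left) (use assms in \<open>auto simp: CFM_carrier\<close>)

lemma CFM_mult_closed: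
  assumes A: "A \<in> carrier (CFM R)" and B: "B \<in> carrier (CFM R)"
  shows "A \<otimes>\<^bsub>CFM R\<^esub> B \<in> carrier (CFM R)"
  unfolding CFM_carrier
proof (intro conjI allI)
  fix i j
  show "(A \<otimes>\<^bsub>CFM R\<^esub> B) i j \<in> carrier R"
    using A B by (auto simp: CFM_carrier intro!: finsum_closed)
next
  fix j
  have "{i. (A \<otimes>\<^bsub>CFM R\<^esub> B) i j \<noteq> \<zero>} \<subseteq> (\<Union>k\<in>{k. B k j \<noteq> \<zero>}. {i. A i k \<noteq> \<zero>})"
  proof (rule subsetI, rule ccontr)
    fix i
    assume 1: "i \<in> {i. (A \<otimes>\<^bsub>CFM R\<^esub> B) i j \<noteq> \<zero>}"
      and 2: "i \<notin> (\<Union>k\<in>{k. B k j \<noteq> \<zero>}. {i. A i k \<noteq> \<zero>})"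
    have "(A \<otimes>\<^bsub>CFM R\<^esub> B) i j = (\<Oplus>k\<in>{k. B k j \<noteq> \<zero>}. \<zero>)"
      unfolding CFM_sel using 2 B by (intro finsum_cong') (auto simp: CFM_carrier)
    with 1 show False by (simp add: finsum_zero)
  qed
  moreover have "finite \<dots>"
    using A B by (auto simp: CFM_carrier)
  ultimately show "finite {i. (A \<otimes>\<^bsub>CFM R\<^esub> B) i j \<noteq> \<zero>}"
    by (rule finite_subset)
qed

lemma CFM_add_closed:
  assumes A: "A \<in> carrier (CFM R)" and B: "B \<in> carrier (CFM R)"
  shows "A \<oplus>\<^bsub>CFM R\<^esub> B \<in> carrier (CFM R)"
proof -
  have "finite {i. A i j \<oplus> B i j \<noteq> \<zero>}" for j
    by (rule finite_subset[of _ "{i. A i j \<noteq> \<zero>} \<union> {i. B i j \<noteq> \<zero>}"])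
       (use A B in \<open>auto simp: CFM_carrier\<close>)
  then show ?thesis using A B by (auto simp: CFM_carrier)
qed

lemma CFM_uminus_closed:
  assumes A: "A \<in> carrier (CFM R)"
  shows "(\<lambda>i j. \<ominus> A i j) \<in> carrier (CFM R)"
proof -
  have "finite {i. \<ominus> A i j \<noteq> \<zero>}" for j
    by (rule finite_subset[of _ "{i. A i j \<noteq> \<zero>}"]) (use A in \<open>auto simp: CFM_carrier\<close>)
  then show ?thesis using A by (auto simp: CFM_carrier)
qed

lemma CFM_one_closed: "\<one>\<^bsub>CFM R\<^esub> \<in> carrier (CFM R)"
proof -
  have "finite {i. (if i = j then \<one> else \<zero>) \<noteq> \<zero>}" for j :: nat
    by (rule finite_subset[of _ "{j}"]) auto
  then show ?thesis by (auto simp: CFM_carrier)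
qed

lemma CFM_assoc:
  assumes A: "A \<in> carrier (CFM R)" and B: "B \<in> carrier (CFM R)" and C: "C \<in> carrier (CFM R)"
  shows "(A \<otimes>\<^bsub>CFM R\<^esub> B) \<otimes>\<^bsub>CFM R\<^esub> C = A \<otimes>\<^bsub>CFM R\<^esub> (B \<otimes>\<^bsub>CFM R\<^esub> C)"
proof (intro ext)
  fix i j
  define L where "L = {l. C l j \<noteq> \<zero>}"
  define K where "K = (\<Union>l\<in>L. {k. B k l \<noteq> \<zero>}) \<union> {k. (B \<otimes>\<^bsub>CFM R\<^esub> C) k j \<noteq> \<zero>}"
  have L: "finite L" using C by (simp add: L_def CFM_carrier)
  have K: "finite K"
    using L B CFM_mult_closed[OF B C] unfolding K_def CFM_carrier by blast
  have c: "A i j \<in> carrier R" "B i j \<in> carrier R" "C i j \<in> carrier R" for i j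
    using A B C by (simp_all add: CFM_carrier)
  have "((A \<otimes>\<^bsub>CFM R\<^esub> B) \<otimes>\<^bsub>CFM R\<^esub> C) i j = (\<Oplus>l\<in>L. (A \<otimes>\<^bsub>CFM R\<^esub> B) i l \<otimes> C l j)"
    by (rule CFM_mult_eq[OF CFM_mult_closed[OF A B] C L]) (simp add: L_def)
  also have "\<dots> = (\<Oplus>l\<in>L. \<Oplus>k\<in>K. A i k \<otimes> B k l \<otimes> C l j)"
  proof (rule finsum_cong')
    fix l assume l: "l \<in> L"
    have "(A \<otimes>\<^bsub>CFM R\<^esub> B) i l = (\<Oplus>k\<in>K. A i k \<otimes> B k l)"
      by (rule CFM_mult_eq[OF A B K]) (use l in \<open>auto simp: K_def\<close>)
    then show "(A \<otimes>\<^bsub>CFM R\<^esub> B) i l \<otimes> C l j = (\<Oplus>k\<in>K. A i k \<otimes> B k l \<otimes> C l j)"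
      using K c by (simp add: finsum_ldistr)
  qed (use c in \<open>auto intro!: finsum_closed\<close>)
  also have "\<dots> = (\<Oplus>k\<in>K. \<Oplus>l\<in>L. A i k \<otimes> B k l \<otimes> C l j)"
    using K L c by (intro finsum_swap) auto
  also have "\<dots> = (\<Oplus>k\<in>K. A i k \<otimes> (B \<otimes>\<^bsub>CFM R\<^esub> C) k j)"
  proof (rule finsum_cong')
    fix k
    have "(B \<otimes>\<^bsub>CFM R\<^esub> C) k j = (\<Oplus>l\<in>L. B k l \<otimes> C l j)"
      by (rule CFM_mult_eq[OF B C L]) (simp add: L_def)
    then show "(\<Oplus>l\<in>L. A i k \<otimes> B k l \<otimes> C l j) = A i k \<otimes> (B \<otimes>\<^bsub>CFM R\<^esub> C) k j"
      using L c by (simp add: finsum_rdistr m_assoc)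
  qed (use c CFM_mult_closed[OF B C] in \<open>auto simp del: CFM_sel simp: CFM_carrier\<close>)
  also have "\<dots> = (A \<otimes>\<^bsub>CFM R\<^esub> (B \<otimes>\<^bsub>CFM R\<^esub> C)) i j"
    by (rule CFM_mult_eq[OF A CFM_mult_closed[OF B C] K, symmetric]) (simp add: K_def del: CFM_sel)
  finally show "((A \<otimes>\<^bsub>CFM R\<^esub> B) \<otimes>\<^bsub>CFM R\<^esub> C) i j = (A \<otimes>\<^bsub>CFM R\<^esub> (B \<otimes>\<^bsub>CFM R\<^esub> C)) i j" .
qed

lemma ring_CFM: "ring (CFM R)"
proof (rule ringI)
  show "abelian_group (CFM R)"
  proof (rule abelian_groupI)
    show "A \<oplus>\<^bsub>CFM R\<^esub> B \<in> carrier (CFM R)"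
      if "A \<in> carrier (CFM R)" "B \<in> carrier (CFM R)" for A B
      using that by (rule CFM_add_closed)
    fix A assume A: "A \<in> carrier (CFM R)"
    show "\<exists>B\<in>carrier (CFM R). B \<oplus>\<^bsub>CFM R\<^esub> A = \<zero>\<^bsub>CFM R\<^esub>"
      by (rule bexI[OF _ CFM_uminus_closed[OF A]])
         (use A in \<open>auto simp: fun_eq_iff CFM_carrier l_neg\<close>)
  qed (auto simp: fun_eq_iff CFM_carrier[of _ R] a_ac)
  show "monoid (CFM R)"
  proof (rule monoidI)
    fix A assume A: "A \<in> carrier (CFM R)"
    show "\<one>\<^bsub>CFM R\<^esub> \<otimes>\<^bsub>CFM R\<^esub> A = A"
    proof (intro ext)
      fix i j
      have "finite (insert i {k. A k j \<noteq> \<zero>})" using A by (auto simp: CFM_carrier)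
      moreover from this have "(\<one>\<^bsub>CFM R\<^esub> \<otimes>\<^bsub>CFM R\<^esub> A) i j =
          (\<Oplus>k\<in>insert i {k. A k j \<noteq> \<zero>}. \<one>\<^bsub>CFM R\<^esub> i k \<otimes> A k j)"
        by (rule CFM_mult_eq[OF CFM_one_closed A]) auto
      moreover have "\<dots> = (\<Oplus>k\<in>insert i {k. A k j \<noteq> \<zero>}. if i = k then A k j else \<zero>)"
        using A by (intro finsum_cong') (auto simp: CFM_carrier)
      ultimately show "(\<one>\<^bsub>CFM R\<^esub> \<otimes>\<^bsub>CFM R\<^esub> A) i j = A i j"
        using A finsum_singleton[of i "insert i {k. A k j \<noteq> \<zero>}" "\<lambda>k. A k j"]
        by (simp add: CFM_carrier del: CFM_sel)
    qed
    show "A \<otimes>\<^bsub>CFM R\<^esub> \<one>\<^bsub>CFM R\<^esub> = A"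
    proof (intro ext)
      fix i j
      have "(A \<otimes>\<^bsub>CFM R\<^esub> \<one>\<^bsub>CFM R\<^esub>) i j = (\<Oplus>k\<in>{j}. A i k \<otimes> \<one>\<^bsub>CFM R\<^esub> k j)"
        by (rule CFM_mult_eq[OF A CFM_one_closed]) auto
      also have "\<dots> = A i j"
        using A by (subst finsum_insert) (auto simp: CFM_carrier)
      finally show "(A \<otimes>\<^bsub>CFM R\<^esub> \<one>\<^bsub>CFM R\<^esub>) i j = A i j" .
    qed
  qed (simp_all add: CFM_mult_closed CFM_one_closed CFM_assoc)
next
  fix A B C
  assume A: "A \<in> carrier (CFM R)" and B: "B \<in> carrier (CFM R)" and C: "C \<in> carrier (CFM R)"
  have c: "A i j \<in> carrier R" "B i j \<in> carrier R" "C i j \<in> carrier R" for i j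
    using A B C by (simp_all add: CFM_carrier)
  show "(A \<oplus>\<^bsub>CFM R\<^esub> B) \<otimes>\<^bsub>CFM R\<^esub> C = A \<otimes>\<^bsub>CFM R\<^esub> C \<oplus>\<^bsub>CFM R\<^esub> B \<otimes>\<^bsub>CFM R\<^esub> C"
    using c by (simp add: fun_eq_iff l_distr finsum_addf)
  show "C \<otimes>\<^bsub>CFM R\<^esub> (A \<oplus>\<^bsub>CFM R\<^esub> B) = C \<otimes>\<^bsub>CFM R\<^esub> A \<oplus>\<^bsub>CFM R\<^esub> C \<otimes>\<^bsub>CFM R\<^esub> B"
  proof (intro ext)
    fix i j
    define K where "K = {k. A k j \<noteq> \<zero>} \<union> {k. B k j \<noteq> \<zero>}"
    have K: "finite K" using A B by (simp add: K_def CFM_carrier)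
    have "(C \<otimes>\<^bsub>CFM R\<^esub> (A \<oplus>\<^bsub>CFM R\<^esub> B)) i j = (\<Oplus>k\<in>K. C i k \<otimes> (A \<oplus>\<^bsub>CFM R\<^esub> B) k j)"
      by (rule CFM_mult_eq[OF C CFM_add_closed[OF A B] K]) (auto simp: K_def)
    also have "\<dots> = (\<Oplus>k\<in>K. C i k \<otimes> A k j) \<oplus> (\<Oplus>k\<in>K. C i k \<otimes> B k j)"
      using c by (simp add: r_distr finsum_addf)
    also have "(\<Oplus>k\<in>K. C i k \<otimes> A k j) = (C \<otimes>\<^bsub>CFM R\<^esub> A) i j"
      by (rule CFM_mult_eq[OF C A K, symmetric]) (auto simp: K_def)
    also have "(\<Oplus>k\<in>K. C i k \<otimes> B k j) = (C \<otimes>\<^bsub>CFM R\<^esub> B) i j"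
      by (rule CFM_mult_eq[OF C B K, symmetric]) (auto simp: K_def)
    finally show "(C \<otimes>\<^bsub>CFM R\<^esub> (A \<oplus>\<^bsub>CFM R\<^esub> B)) i j =
        (C \<otimes>\<^bsub>CFM R\<^esub> A \<oplus>\<^bsub>CFM R\<^esub> C \<otimes>\<^bsub>CFM R\<^esub> B) i j" by simp
  qed
qed

lemma CFM_a_inv:
  assumes A: "A \<in> carrier (CFM R)"
  shows "\<ominus>\<^bsub>CFM R\<^esub> A = (\<lambda>i j. \<ominus> A i j)"
proof -
  interpret M: ring "CFM R" by (rule ring_CFM)
  show ?thesis
    by (rule M.minus_equality[OF _ A CFM_uminus_closed[OF A]])
       (use A in \<open>auto simp: fun_eq_iff CFM_carrier l_neg\<close>)
qed

lemma subring_LTDFM: "subring (carrier (LTDFM R)) (CFM R)"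
proof -
  interpret M: ring "CFM R" by (rule ring_CFM)
  have carr: "carrier (LTDFM R) =
      {A \<in> carrier (CFM R). lower_triangular R A \<and> diagonal_finite R A}"
    by (simp add: LTDFM_def)
  show ?thesis
  proof (rule M.subringI)
    show "carrier (LTDFM R) \<subseteq> carrier (CFM R)" by (auto simp: carr)
    show "\<one>\<^bsub>CFM R\<^esub> \<in> carrier (LTDFM R)"
      by (auto simp: carr CFM_one_closed lower_triangular_def diagonal_finite_def)
    fix A assume "A \<in> carrier (LTDFM R)"
    then have A: "A \<in> carrier (CFM R)" and lA: "lower_triangular R A"
      and "diagonal_finite R A" by (auto simp: carr)
    then obtain m where m: "m \<ge> 1" "\<And>i j. i \<ge> j + m \<Longrightarrow> A i j = \<zero>"
      by (auto simp: diagonal_finite_def)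
    have "diagonal_finite R (\<lambda>i j. \<ominus> A i j)"
      unfolding diagonal_finite_def using m by (intro exI[of _ m]) auto
    moreover have "lower_triangular R (\<lambda>i j. \<ominus> A i j)"
      using lA by (simp add: lower_triangular_def)
    ultimately show "\<ominus>\<^bsub>CFM R\<^esub> A \<in> carrier (LTDFM R)"
      using A by (simp add: carr CFM_a_inv CFM_uminus_closed)
    fix B assume "B \<in> carrier (LTDFM R)"
    then have B: "B \<in> carrier (CFM R)" and lB: "lower_triangular R B"
      and "diagonal_finite R B" by (auto simp: carr)
    then obtain n where n: "n \<ge> 1" "\<And>i j. i \<ge> j + n \<Longrightarrow> B i j = \<zero>"
      by (auto simp: diagonal_finite_def)
    have c: "A i j \<in> carrier R" "B i j \<in> carrier R" for i j
      using A B by (simp_all add: CFM_carrier)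
    have "diagonal_finite R (A \<oplus>\<^bsub>CFM R\<^esub> B)"
      unfolding diagonal_finite_def using m n by (intro exI[of _ "m + n"]) auto
    then show "A \<oplus>\<^bsub>CFM R\<^esub> B \<in> carrier (LTDFM R)"
      using lA lB by (auto simp: carr CFM_add_closed A B lower_triangular_def)
    have z: "(A \<otimes>\<^bsub>CFM R\<^esub> B) i j = \<zero>" if "\<And>k. B k j \<noteq> \<zero> \<Longrightarrow> A i k = \<zero>" for i j
    proof -
      have "(A \<otimes>\<^bsub>CFM R\<^esub> B) i j = (\<Oplus>k\<in>{k. B k j \<noteq> \<zero>}. \<zero>)"
        unfolding CFM_sel using that c by (intro finsum_cong') auto
      then show ?thesis by (simp add: finsum_zero)
    qed
    have "lower_triangular R (A \<otimes>\<^bsub>CFM R\<^esub> B)"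
      unfolding lower_triangular_def
    proof (intro allI impI z)
      fix i j k :: nat assume "i < j" "B k j \<noteq> \<zero>"
      then have "i < k" using lB unfolding lower_triangular_def by (meson leI order_less_le_trans)
      then show "A i k = \<zero>" using lA by (simp add: lower_triangular_def)
    qed
    moreover have "diagonal_finite R (A \<otimes>\<^bsub>CFM R\<^esub> B)"
      unfolding diagonal_finite_def
    proof (intro exI[of _ "m + n"] conjI allI impI z)
      fix i j k :: nat assume "j + (m + n) \<le> i" "B k j \<noteq> \<zero>"
      moreover from this have "k < j + n" using n(2) by (meson leI)
      ultimately show "A i k = \<zero>" by (intro m(2)) simp
    qed (use m in simp)
    ultimately show "A \<otimes>\<^bsub>CFM R\<^esub> B \<in> carrier (LTDFM R)"
      by (simp add: carr CFM_mult_closed A B)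
  qed
qed

lemma ring_LTDFM: "ring (LTDFM R)"
proof -
  interpret M: ring "CFM R" by (rule ring_CFM)
  have "LTDFM R = (CFM R)\<lparr>carrier := carrier (LTDFM R)\<rparr>" by (simp add: LTDFM_def)
  then show ?thesis using M.subring_is_ring[OF subring_LTDFM] by simp
qed

end

end

theory Submission
  imports Defs
begin

text \<open>
  The exchange condition already fails at the shift matrix \<open>X\<close>, which has ones just below the
  diagonal and zeros elsewhere. Right multiplication by \<open>X\<close> moves the columns of a matrix one
  place to the left, so every multiple \<open>T X\<close> with \<open>T\<close> lower triangular is strictly lower
  triangular, and a strictly lower triangular idempotent is zero
  (\<open>strictly_lower_idempotent_zero\<close>). The only idempotent available for \<open>X\<close> is therefore \<open>0\<close>,
  and the exchange condition would make \<open>1 - X\<close> left invertible. But the lower triangular left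
  inverse of \<open>1 - X\<close> can only be the geometric series \<open>1 + X + X\<^sup>2 + \<dots>\<close>, whose entries on and
  below the diagonal are all \<open>1\<close> (\<open>left_inverse_one_minus_shift\<close>); over a nonzero ring this
  matrix is not diagonal-finite.
\<close>

definition shift_matrix :: "('a, 'b) ring_scheme \<Rightarrow> nat \<Rightarrow> nat \<Rightarrow> 'a" where
  "shift_matrix R i j = (if i = Suc j then \<one>\<^bsub>R\<^esub> else \<zero>\<^bsub>R\<^esub>)"

lemma LTDFM_carrier:
  "A \<in> carrier (LTDFM R) \<longleftrightarrow>
     A \<in> carrier (CFM R) \<and> lower_triangular R A \<and> diagonal_finite R A"
  by (simp add: LTDFM_def)

lemma LTDFM_ops [simp]:
  "monoid.mult (LTDFM R) = monoid.mult (CFM R)"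
  "one (LTDFM R) = one (CFM R)"
  "zero (LTDFM R) = zero (CFM R)"
  "add (LTDFM R) = add (CFM R)"
  by (simp_all add: LTDFM_def)

lemma LTDFM_entry_closed: "A \<in> carrier (LTDFM R) \<Longrightarrow> A i j \<in> carrier R"
  by (simp add: LTDFM_carrier CFM_carrier)

context ring
begin

lemma LTDFM_minus_entry:
  assumes A: "A \<in> carrier (LTDFM R)" and B: "B \<in> carrier (LTDFM R)"
  shows "(A \<ominus>\<^bsub>LTDFM R\<^esub> B) i j = A i j \<ominus> B i j"
proof -
  interpret L: ring "LTDFM R" by (rule ring_LTDFM)
  have "(\<ominus>\<^bsub>LTDFM R\<^esub> B \<oplus>\<^bsub>LTDFM R\<^esub> B) i j = \<zero>"
    using B by (simp only: L.l_neg) simp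
  then have "(\<ominus>\<^bsub>LTDFM R\<^esub> B) i j \<oplus> B i j = \<zero>" by simp
  then have "(\<ominus>\<^bsub>LTDFM R\<^esub> B) i j = \<ominus> B i j"
    using B by (metis minus_equality LTDFM_entry_closed L.a_inv_closed)
  then show ?thesis by (simp add: a_minus_def)
qed

lemma shift_matrix_closed: "shift_matrix R \<in> carrier (LTDFM R)"
proof -
  have "finite {i. shift_matrix R i j \<noteq> \<zero>}" for j
    by (rule finite_subset[of _ "{Suc j}"]) (auto simp: shift_matrix_def)
  moreover have "diagonal_finite R (shift_matrix R)"
    unfolding diagonal_finite_def
    by (intro exI[of _ 2]) (auto simp: shift_matrix_def)
  ultimately show ?thesis
    by (auto simp: LTDFM_carrier CFM_carrier lower_triangular_def shift_matrix_def)
qed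

lemma mult_shift_matrix:
  assumes A: "A \<in> carrier (CFM R)"
  shows "(A \<otimes>\<^bsub>CFM R\<^esub> shift_matrix R) i j = A i (Suc j)"
proof -
  have "shift_matrix R \<in> carrier (CFM R)"
    using shift_matrix_closed by (simp add: LTDFM_carrier)
  then have "(A \<otimes>\<^bsub>CFM R\<^esub> shift_matrix R) i j = (\<Oplus>k\<in>{Suc j}. A i k \<otimes> shift_matrix R k j)"
    by (intro CFM_mult_eq[OF A]) (auto simp: shift_matrix_def)
  also have "\<dots> = A i (Suc j)"
    using A by (subst finsum_insert) (auto simp: CFM_carrier shift_matrix_def)
  finally show ?thesis .
qed

text \<open>
  In the product \<open>E E\<close>, an entry on one subdiagonal is a sum of products of entries on strictly
  higher subdiagonals, so the subdiagonals of \<open>E = E E\<close> vanish one after the other. A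
  strictly lower triangular matrix of infinite size, such as \<open>X\<close>, need not be nilpotent, so the
  conclusion has to be reached entry by entry.
\<close>

lemma strictly_lower_idempotent_zero:
  assumes E: "E \<in> carrier (CFM R)" and idem: "E \<otimes>\<^bsub>CFM R\<^esub> E = E"
    and strict: "\<And>i j. i \<le> j \<Longrightarrow> E i j = \<zero>"
  shows "E i j = \<zero>"
proof (induction "i - j" arbitrary: j rule: less_induct)
  case less
  have "E i j = (\<Oplus>k\<in>{k. E k j \<noteq> \<zero>}. E i k \<otimes> E k j)"
    by (subst idem[symmetric]) (rule CFM_sel)
  also have "\<dots> = (\<Oplus>k\<in>{k. E k j \<noteq> \<zero>}. \<zero>)"
  proof (rule finsum_cong')
    fix k assume "k \<in> {k. E k j \<noteq> \<zero>}"
    then have "j < k" using strict[of k j] by force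
    then have "E i k = \<zero>" using strict[of i k] less[of k] by (cases "i \<le> k") auto
    then show "E i k \<otimes> E k j = \<zero>" using E by (simp add: CFM_carrier)
  qed auto
  finally show ?case by (simp add: finsum_zero)
qed

text \<open>
  Comparing entries, \<open>S (1 - X) = 1\<close> says that neighbouring entries of a row of \<open>S\<close> agree,
  except that passing from the diagonal entry to the one on its right subtracts \<open>1\<close>. Lower
  triangularity makes the latter entry \<open>0\<close>; the row is then determined from right to left.
\<close>

lemma left_inverse_one_minus_shift:
  assumes S: "S \<in> carrier (LTDFM R)"
    and inv: "S \<otimes>\<^bsub>LTDFM R\<^esub> (\<one>\<^bsub>LTDFM R\<^esub> \<ominus>\<^bsub>LTDFM R\<^esub> shift_matrix R) = \<one>\<^bsub>LTDFM R\<^esub>"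
    and "j \<le> i"
  shows "S i j = \<one>"
proof -
  interpret L: ring "LTDFM R" by (rule ring_LTDFM)
  note X = shift_matrix_closed
  have c: "S i j \<in> carrier R" for i j using S by (rule LTDFM_entry_closed)
  have "S \<ominus>\<^bsub>LTDFM R\<^esub> S \<otimes>\<^bsub>LTDFM R\<^esub> shift_matrix R = \<one>\<^bsub>LTDFM R\<^esub>"
    using inv S X by (simp only: L.minus_eq L.r_distr L.r_minus L.r_one L.one_closed
        L.a_inv_closed L.m_closed)
  then have "S i j \<ominus> (S \<otimes>\<^bsub>LTDFM R\<^esub> shift_matrix R) i j = (if i = j then \<one> else \<zero>)" for i j
    using LTDFM_minus_entry[OF S L.m_closed[OF S X], of i j] by (simp del: CFM_sel(1))
  then have diff: "S i j \<ominus> S i (Suc j) = (if i = j then \<one> else \<zero>)" for i j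
    using S by (simp add: mult_shift_matrix LTDFM_carrier del: CFM_sel)
  have rec: "S i j = (if i = j then \<one> else \<zero>) \<oplus> S i (Suc j)" for i j
    unfolding diff[symmetric] using c by (simp add: a_minus_def a_assoc l_neg)
  show ?thesis using \<open>j \<le> i\<close>
  proof (induction j rule: inc_induct)
    case base
    have "S i (Suc i) = \<zero>" using S by (simp add: LTDFM_carrier lower_triangular_def)
    then show ?case using rec[of i i] by simp
  next
    case (step j)
    then show ?case using rec[of i j] by simp
  qed
qed

end

theorem theorem5p4:
  fixes R :: "('a, 'b) ring_scheme"
  assumes "ring R"
    and "carrier R \<noteq> {\<zero>\<^bsub>R\<^esub>}"
  shows "\<not> exchange_ring (LTDFM R)"
proof
  assume exch: "exchange_ring (LTDFM R)"
  interpret ring R by fact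
  interpret L: ring "LTDFM R" by (rule ring_LTDFM)
  obtain E S T where E: "E \<in> carrier (LTDFM R)" and idem: "E \<otimes>\<^bsub>LTDFM R\<^esub> E = E"
    and T: "T \<in> carrier (LTDFM R)" and ET: "E = T \<otimes>\<^bsub>LTDFM R\<^esub> shift_matrix R"
    and S: "S \<in> carrier (LTDFM R)"
    and ES: "\<one>\<^bsub>LTDFM R\<^esub> \<ominus>\<^bsub>LTDFM R\<^esub> E =
      S \<otimes>\<^bsub>LTDFM R\<^esub> (\<one>\<^bsub>LTDFM R\<^esub> \<ominus>\<^bsub>LTDFM R\<^esub> shift_matrix R)"
    using exch shift_matrix_closed unfolding exchange_ring_def by blast
  have "E i j = T i (Suc j)" for i j
    using T by (simp add: ET mult_shift_matrix LTDFM_carrier del: CFM_sel)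
  then have strict: "E i j = \<zero>\<^bsub>R\<^esub>" if "i \<le> j" for i j
    using T that by (simp add: LTDFM_carrier lower_triangular_def)
  have "E \<in> carrier (CFM R)" and "E \<otimes>\<^bsub>CFM R\<^esub> E = E"
    using E idem by (simp_all only: LTDFM_carrier LTDFM_ops)
  then have "E i j = \<zero>\<^bsub>R\<^esub>" for i j
    using strict by (rule strictly_lower_idempotent_zero)
  then have "E = \<zero>\<^bsub>LTDFM R\<^esub>" by (simp add: fun_eq_iff)
  then have "S \<otimes>\<^bsub>LTDFM R\<^esub> (\<one>\<^bsub>LTDFM R\<^esub> \<ominus>\<^bsub>LTDFM R\<^esub> shift_matrix R) = \<one>\<^bsub>LTDFM R\<^esub>"
    using ES by (simp only: L.minus_eq L.minus_zero L.r_zero L.one_closed)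
  then have "S n 0 = \<one>\<^bsub>R\<^esub>" for n
    using left_inverse_one_minus_shift[OF S] by simp
  moreover obtain n where "\<forall>j. \<forall>i\<ge>j + n. S i j = \<zero>\<^bsub>R\<^esub>"
    using S unfolding LTDFM_carrier diagonal_finite_def by blast
  then have "S n 0 = \<zero>\<^bsub>R\<^esub>" by simp
  ultimately show False
    using assms(2) carrier_one_not_zero by simp
qed

end
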